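(* Let $A$ be a commutative ring with unit and let $E$ be a left $A$-module with a projective basis $e_1,\dots,e_n\in E$, $x_1,\dots,x_n\in E^*=\operatorname{Hom}_A(E,A)$. Let $I$ be a left and right $A$-module (an $A$-bimodule) and let $d\in\operatorname{Der}_{\mathbf{Z}}(A,I)$ be a derivation. Define \[\nabla:E\to I\otimes_A E,\qquad \nabla(e)=\sum_{i=1}^n d(x_i(e))\otimes e_i,\] \[\nabla':\operatorname{Der}_{\mathbf{Z}}(A)\to\operatorname{End}_{\mathbf{Z}}(E),\qquad \nabla'(\delta)(e)=\sum_{i=1}^n\delta(x_i(e))e_i.\] Then $\nabla$ and $\nabla'$ are connections on $E$.
   Context: Projective basis: finite families $e_1,\dots,e_n\in E$ and $x_1,\dots,x_n\in E^*$ with $\sum_j x_j(e)e_j=e$ for all $e\in E$. $\mathbf{Z}$ is the ring of integers. $\operatorname{Der}_{\mathbf{Z}}(A,I)$ is the set of additive maps $d:A\to I$ with $d(ab)=a\,d(b)+d(a)\,b$; $\operatorname{Der}_{\mathbf{Z}}(A)=\operatorname{Der}_{\mathbf{Z}}(A,A)$. The tensor product $I\otimes_A E$ uses the right $A$-module structure of $I$, and it is a left $A$-module via the left structure of $I$. A map $\nabla:E\to I\otimes_A E$ is a connection (an $I$-connection with respect to $d$) if it is additive and $\nabla(ae)=a\nabla(e)+d(a)\otimes e$ for all $a\in A$, $e\in E$. A map $\nabla':\operatorname{Der}_{\mathbf{Z}}(A)\to\operatorname{End}_{\mathbf{Z}}(E)$ is a connection if it is $A$-linear and $\nabla'(\delta)(ae)=a\nabla'(\delta)(e)+\delta(a)e$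 for all $a\in A$, $e\in E$, $\delta\in\operatorname{Der}_{\mathbf{Z}}(A)$. *)

theory Defs
  imports "HOL-Algebra.Module" "HOL-Algebra.Generated_Groups" "HOL-Algebra.Free_Abelian_Groups"
begin

text \<open>
  The additive structure and the left action of a bimodule are those of the underlying
  \<open>module\<close>; the right action is a separate field, since over a commutative ring the
  two actions need not agree.
\<close>

record ('a, 'b) bimodule = "('a, 'b) module" +
  rsmult :: "['b, 'a] \<Rightarrow> 'b" (infixl \<open>\<triangleleft>\<index>\<close> 70)

locale bimodule = module A I
  for A :: "('a, 'r) ring_scheme" (structure) and I :: "('a, 'b, 't) bimodule_scheme" (structure) +
  assumes rsmult_closed:
      "\<lbrakk>a \<in> carrier A; x \<in> carrier I\<rbrakk> \<Longrightarrow> x \<triangleleft>\<^bsub>I\<^esub> a \<in> carrier I"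
    and rsmult_r_distr:
      "\<lbrakk>a \<in> carrier A; b \<in> carrier A; x \<in> carrier I\<rbrakk> \<Longrightarrow>
        x \<triangleleft>\<^bsub>I\<^esub> (a \<oplus> b) = x \<triangleleft>\<^bsub>I\<^esub> a \<oplus>\<^bsub>I\<^esub> x \<triangleleft>\<^bsub>I\<^esub> b"
    and rsmult_l_distr:
      "\<lbrakk>a \<in> carrier A; x \<in> carrier I; y \<in> carrier I\<rbrakk> \<Longrightarrow>
        (x \<oplus>\<^bsub>I\<^esub> y) \<triangleleft>\<^bsub>I\<^esub> a = x \<triangleleft>\<^bsub>I\<^esub> a \<oplus>\<^bsub>I\<^esub> y \<triangleleft>\<^bsub>I\<^esub> a"
    and rsmult_assoc:
      "\<lbrakk>a \<in> carrier A; b \<in> carrier A; x \<in> carrier I\<rbrakk> \<Longrightarrow>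
        x \<triangleleft>\<^bsub>I\<^esub> (a \<otimes> b) = (x \<triangleleft>\<^bsub>I\<^esub> a) \<triangleleft>\<^bsub>I\<^esub> b"
    and rsmult_one:
      "x \<in> carrier I \<Longrightarrow> x \<triangleleft>\<^bsub>I\<^esub> \<one> = x"
    and smult_rsmult_assoc:
      "\<lbrakk>a \<in> carrier A; b \<in> carrier A; x \<in> carrier I\<rbrakk> \<Longrightarrow>
        (a \<odot>\<^bsub>I\<^esub> x) \<triangleleft>\<^bsub>I\<^esub> b = a \<odot>\<^bsub>I\<^esub> (x \<triangleleft>\<^bsub>I\<^esub> b)"

definition self_bimodule :: "('a, 'r) ring_scheme \<Rightarrow> ('a, 'a) bimodule" where
  "self_bimodule A =
    \<lparr>carrier = carrier A, monoid.mult = monoid.mult A, one = \<one>\<^bsub>A\<^esub>, ring.zero = \<zero>\<^bsub>A\<^esub>, add = add A,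
     smult = monoid.mult A, rsmult = monoid.mult A\<rparr>"

definition module_hom ::
  "('a, 'r) ring_scheme \<Rightarrow> ('a, 'm, 's) module_scheme \<Rightarrow> ('a, 'n, 't) module_scheme \<Rightarrow> ('m \<Rightarrow> 'n) set"
  where
  "module_hom A M N =
    {f \<in> hom (add_monoid M) (add_monoid N).
      \<forall>a\<in>carrier A. \<forall>v\<in>carrier M. f (a \<odot>\<^bsub>M\<^esub> v) = a \<odot>\<^bsub>N\<^esub> f v}"

definition dual_module ::
  "('a, 'r) ring_scheme \<Rightarrow> ('a, 'e, 's) module_scheme \<Rightarrow> ('e \<Rightarrow> 'a) set" where
  "dual_module A E = module_hom A E (self_bimodule A)"

definition projective_basis ::
  "('a, 'r) ring_scheme \<Rightarrow> ('a, 'e, 's) module_scheme \<Rightarrow> nat \<Rightarrow> (nat \<Rightarrow> 'e) \<Rightarrow> (nat \<Rightarrow> 'e \<Rightarrow> 'a) \<Rightarrow> bool"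
  where
  "projective_basis A E n e x \<longleftrightarrow>
    (\<forall>j\<in>{1..n}. e j \<in> carrier E) \<and>
    (\<forall>j\<in>{1..n}. x j \<in> dual_module A E) \<and>
    (\<forall>v\<in>carrier E. (\<Oplus>\<^bsub>E\<^esub>j\<in>{1..n}. x j v \<odot>\<^bsub>E\<^esub> e j) = v)"

text \<open>
  Derivations and endomorphisms are required to be extensional (undefined outside the carrier),
  so that equality of such maps is equality on the carrier and the pointwise operations
  make these sets into \<open>A\<close>-modules.
\<close>

definition derivations ::
  "('a, 'r) ring_scheme \<Rightarrow> ('a, 'i, 't) bimodule_scheme \<Rightarrow> ('a \<Rightarrow> 'i) set" where
  "derivations A I =
    {d \<in> extensional (carrier A) \<inter> hom (add_monoid A) (add_monoid I).
      \<forall>a\<in>carrier A. \<forall>b\<in>carrier A.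
        d (a \<otimes>\<^bsub>A\<^esub> b) = a \<odot>\<^bsub>I\<^esub> d b \<oplus>\<^bsub>I\<^esub> d a \<triangleleft>\<^bsub>I\<^esub> b}"

text \<open>
  The record type \<open>module\<close> extends \<open>ring\<close>, so module records carry multiplicative
  fields; the locale \<open>module\<close> does not constrain them.
\<close>

definition derivation_module ::
  "('a, 'r) ring_scheme \<Rightarrow> ('a, 'i, 't) bimodule_scheme \<Rightarrow> ('a, 'a \<Rightarrow> 'i) module" where
  "derivation_module A I =
    \<lparr>carrier = derivations A I, monoid.mult = undefined, one = undefined,
     ring.zero = (\<lambda>b\<in>carrier A. \<zero>\<^bsub>I\<^esub>), add = (\<lambda>d d'. \<lambda>b\<in>carrier A. d b \<oplus>\<^bsub>I\<^esub> d' b),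
     smult = (\<lambda>a d. \<lambda>b\<in>carrier A. a \<odot>\<^bsub>I\<^esub> d b)\<rparr>"

definition endo_module :: "('a, 'e, 's) module_scheme \<Rightarrow> ('a, 'e \<Rightarrow> 'e) module" where
  "endo_module E =
    \<lparr>carrier = extensional (carrier E) \<inter> hom (add_monoid E) (add_monoid E),
     monoid.mult = undefined, one = undefined,
     ring.zero = (\<lambda>v\<in>carrier E. \<zero>\<^bsub>E\<^esub>), add = (\<lambda>f g. \<lambda>v\<in>carrier E. f v \<oplus>\<^bsub>E\<^esub> g v),
     smult = (\<lambda>a f. \<lambda>v\<in>carrier E. a \<odot>\<^bsub>E\<^esub> f v)\<rparr>"

text \<open>
  The tensor product of \<open>I\<close> (with its right action) and \<open>E\<close> is the free abelian
  group on pairs modulo the subgroup generated by the biadditivity and balancing relations.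
\<close>

definition tensor_free ::
  "('a, 'i, 't) bimodule_scheme \<Rightarrow> ('a, 'e, 's) module_scheme \<Rightarrow> ('i \<times> 'e \<Rightarrow>\<^sub>0 int) monoid" where
  "tensor_free I E = free_Abelian_group (carrier I \<times> carrier E)"

definition tensor_relators ::
  "('a, 'r) ring_scheme \<Rightarrow> ('a, 'i, 't) bimodule_scheme \<Rightarrow> ('a, 'e, 's) module_scheme
    \<Rightarrow> ('i \<times> 'e \<Rightarrow>\<^sub>0 int) set" where
  "tensor_relators A I E =
    {frag_of (i \<oplus>\<^bsub>I\<^esub> i', v) - frag_of (i, v) - frag_of (i', v) | i i' v.
      i \<in> carrier I \<and> i' \<in> carrier I \<and> v \<in> carrier E} \<union>
    {frag_of (i, v \<oplus>\<^bsub>E\<^esub> v') - frag_of (i, v) - frag_of (i, v') | i v v'.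
      i \<in> carrier I \<and> v \<in> carrier E \<and> v' \<in> carrier E} \<union>
    {frag_of (i \<triangleleft>\<^bsub>I\<^esub> a, v) - frag_of (i, a \<odot>\<^bsub>E\<^esub> v) | i a v.
      i \<in> carrier I \<and> a \<in> carrier A \<and> v \<in> carrier E}"

definition tensor_kernel ::
  "('a, 'r) ring_scheme \<Rightarrow> ('a, 'i, 't) bimodule_scheme \<Rightarrow> ('a, 'e, 's) module_scheme
    \<Rightarrow> ('i \<times> 'e \<Rightarrow>\<^sub>0 int) set" where
  "tensor_kernel A I E = generate (tensor_free I E) (tensor_relators A I E)"

definition tensor_action ::
  "('a, 'i, 't) bimodule_scheme \<Rightarrow> 'a \<Rightarrow> ('i \<times> 'e \<Rightarrow>\<^sub>0 int) \<Rightarrow> ('i \<times> 'e \<Rightarrow>\<^sub>0 int)" where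
  "tensor_action I a = frag_extend (\<lambda>(i, v). frag_of (a \<odot>\<^bsub>I\<^esub> i, v))"

text \<open>
  The elements are cosets of the kernel. The scalar action sends the coset of \<open>c\<close> to the coset of
  \<open>tensor_action I a c\<close>, written without choosing a representative as the sum of the
  kernel and the image of the coset.
\<close>

definition tensor_product ::
  "('a, 'r) ring_scheme \<Rightarrow> ('a, 'i, 't) bimodule_scheme \<Rightarrow> ('a, 'e, 's) module_scheme
    \<Rightarrow> ('a, ('i \<times> 'e \<Rightarrow>\<^sub>0 int) set) module" where
  "tensor_product A I E =
    \<lparr>carrier = carrier (tensor_free I E Mod tensor_kernel A I E),
     monoid.mult = undefined, one = undefined,
     ring.zero = \<one>\<^bsub>tensor_free I E Mod tensor_kernel A I E\<^esub>,
     add = monoid.mult (tensor_free I E Mod tensor_kernel A I E),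
     smult = (\<lambda>a C. tensor_kernel A I E <#>\<^bsub>tensor_free I E\<^esub> (tensor_action I a ` C))\<rparr>"

definition pure_tensor ::
  "('a, 'r) ring_scheme \<Rightarrow> ('a, 'i, 't) bimodule_scheme \<Rightarrow> ('a, 'e, 's) module_scheme
    \<Rightarrow> 'i \<Rightarrow> 'e \<Rightarrow> ('i \<times> 'e \<Rightarrow>\<^sub>0 int) set" where
  "pure_tensor A I E i v = tensor_kernel A I E #>\<^bsub>tensor_free I E\<^esub> frag_of (i, v)"

definition connection ::
  "('a, 'r) ring_scheme \<Rightarrow> ('a, 'i, 't) bimodule_scheme \<Rightarrow> ('a, 'e, 's) module_scheme
    \<Rightarrow> ('a \<Rightarrow> 'i) \<Rightarrow> ('e \<Rightarrow> ('i \<times> 'e \<Rightarrow>\<^sub>0 int) set) \<Rightarrow> bool" where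
  "connection A I E d D \<longleftrightarrow>
    D \<in> hom (add_monoid E) (add_monoid (tensor_product A I E)) \<and>
    (\<forall>a\<in>carrier A. \<forall>v\<in>carrier E.
      D (a \<odot>\<^bsub>E\<^esub> v) =
        a \<odot>\<^bsub>tensor_product A I E\<^esub> D v \<oplus>\<^bsub>tensor_product A I E\<^esub> pure_tensor A I E (d a) v)"

definition der_connection ::
  "('a, 'r) ring_scheme \<Rightarrow> ('a, 'e, 's) module_scheme \<Rightarrow> (('a \<Rightarrow> 'a) \<Rightarrow> 'e \<Rightarrow> 'e) \<Rightarrow> bool" where
  "der_connection A E D \<longleftrightarrow>
    D \<in> module_hom A (derivation_module A (self_bimodule A)) (endo_module E) \<and>
    (\<forall>\<delta>\<in>derivations A (self_bimodule A). \<forall>a\<in>carrier A. \<forall>v\<in>carrier E.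
      D \<delta> (a \<odot>\<^bsub>E\<^esub> v) = a \<odot>\<^bsub>E\<^esub> D \<delta> v \<oplus>\<^bsub>E\<^esub> \<delta> a \<odot>\<^bsub>E\<^esub> v)"

end

theory Submission
  imports Defs
begin

text \<open>
  Expanding \<open>d (x i (a v)) = a d (x i v) + d a x i v\<close> and summing, the second part
  contributes \<open>d a \<otimes> (\<Sum> x i v e i) = d a \<otimes> v\<close> once the scalars \<open>x i v\<close> are moved
  across the tensor sign. The scalar action on the tensor product sends cosets to cosets because
  it maps each relator to a relator; for the balancing relators this uses that the two
  actions on \<open>I\<close> commute.
\<close>

section \<open>Finite sums and additive maps\<close>

text \<open>Induction on \<open>S\<close>. It serves to pull a scalar out of a sum in the tensor
  product and to bring a sum inside the second slot of a tensor.\<close>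

lemma hom_finsum:
  assumes "abelian_group M" "abelian_group N" "h \<in> hom (add_monoid M) (add_monoid N)"
    and "f \<in> S \<rightarrow> carrier M" "finite S"
  shows "h (finsum M f S) = finsum N (\<lambda>s. h (f s)) S"
proof -
  interpret M: abelian_group M by fact
  interpret N: abelian_group N by fact
  interpret h: group_hom "add_monoid M" "add_monoid N" h
    using assms(3) by (intro group_hom.intro group_hom_axioms.intro M.a_group N.a_group)
  from assms(5,4) show ?thesis
  proof (induction S)
    case empty
    show ?case using h.hom_one by simp
  next
    case (insert s S)
    have "\<And>u. u \<in> carrier M \<Longrightarrow> h u \<in> carrier N"
      using h.hom_closed by simp
    moreover have "h (u \<oplus>\<^bsub>M\<^esub> v) = h u \<oplus>\<^bsub>N\<^esub> h v" if "u \<in> carrier M" "v \<in> carrier M" for u v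
      using h.hom_mult that by simp
    ultimately show ?case
      using insert by (simp add: Pi_iff)
  qed
qed

text \<open>Since addition commutes, the sum over \<open>J\<close> of
  \<open>f j v \<oplus> f j w\<close> splits into two sums. This gives additivity in the vector for
  both connections. An infinite \<open>J\<close> is covered as well, because the sum then takes its
  default value zero.\<close>

lemma (in abelian_group) finsum_hom_add:
  assumes "\<And>j. j \<in> J \<Longrightarrow> f j \<in> hom N (add_monoid G)"
  shows "(\<lambda>v. \<Oplus>j\<in>J. f j v) \<in> hom N (add_monoid G)"
proof (rule homI)
  have closed: "f j v \<in> carrier G" if "j \<in> J" "v \<in> carrier N" for j v
    using hom_in_carrier[OF assms] that by auto
  fix v w assume v: "v \<in> carrier N" and w: "w \<in> carrier N"
  then show "(\<Oplus>j\<in>J. f j v) \<in> carrier (add_monoid G)"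
    using closed by (simp add: finsum_closed)
  have "(\<Oplus>j\<in>J. f j (v \<otimes>\<^bsub>N\<^esub> w)) = (\<Oplus>j\<in>J. f j v \<oplus> f j w)"
    using hom_mult[OF assms] closed v w by (intro finsum_cong') auto
  then show "(\<Oplus>j\<in>J. f j (v \<otimes>\<^bsub>N\<^esub> w)) = (\<Oplus>j\<in>J. f j v) \<otimes>\<^bsub>add_monoid G\<^esub> (\<Oplus>j\<in>J. f j w)"
    using closed v w by (simp add: finsum_addf)
qed

section \<open>The left scalar action on the free abelian group\<close>

lemma tensor_action_add: "tensor_action I a (c + c') = tensor_action I a c + tensor_action I a c'"
  by (simp add: tensor_action_def frag_extend_add)

lemma tensor_action_diff: "tensor_action I a (c - c') = tensor_action I a c - tensor_action I a c'"
  by (simp add: tensor_action_def frag_extend_diff)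

lemma tensor_action_minus: "tensor_action I a (- c) = - tensor_action I a c"
  by (simp add: tensor_action_def frag_extend_minus)

lemma tensor_action_frag_of: "tensor_action I a (frag_of (i, v)) = frag_of (a \<odot>\<^bsub>I\<^esub> i, v)"
  by (simp add: tensor_action_def)

section \<open>The tensor product as an abelian group with a scalar action\<close>

locale tensor_factors = E: module A E + I: bimodule A I
  for A :: "('a, 'r) ring_scheme" and I :: "('a, 'i, 't) bimodule_scheme"
    and E :: "('a, 'e, 's) module_scheme"
begin

abbreviation "F \<equiv> tensor_free I E"
abbreviation "K \<equiv> tensor_kernel A I E"
abbreviation "T \<equiv> tensor_product A I E"

sublocale F: comm_group F
  unfolding tensor_free_def by (rule abelian_free_Abelian_group)

lemma carrier_F: "c \<in> carrier F \<longleftrightarrow> Poly_Mapping.keys c \<subseteq> carrier I \<times> carrier E"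
  by (simp add: tensor_free_def)

lemma mult_F [simp]: "c \<otimes>\<^bsub>F\<^esub> c' = c + c'"
  by (simp add: tensor_free_def)

lemma one_F: "\<one>\<^bsub>F\<^esub> = 0"
  by (simp add: tensor_free_def)

lemma inv_F: "c \<in> carrier F \<Longrightarrow> inv\<^bsub>F\<^esub> c = - c"
  by (simp add: tensor_free_def)

lemma frag_of_F [simp]: "frag_of (i, v) \<in> carrier F \<longleftrightarrow> i \<in> carrier I \<and> v \<in> carrier E"
  by (simp add: carrier_F)

lemma diff_F: "c \<in> carrier F \<Longrightarrow> c' \<in> carrier F \<Longrightarrow> c - c' \<in> carrier F"
  using F.m_closed[OF _ F.inv_closed, of c c'] by (simp add: inv_F)

lemma relators_F: "tensor_relators A I E \<subseteq> carrier F"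
  by (auto simp: tensor_relators_def I.rsmult_closed intro!: diff_F)

lemma subgroup_K: "subgroup K F"
  unfolding tensor_kernel_def by (rule F.generate_is_subgroup[OF relators_F])

lemma normal_K: "K \<lhd> F"
  by (rule F.subgroup_imp_normal[OF subgroup_K])

lemma K_subset: "K \<subseteq> carrier F"
  by (rule subgroup.subset[OF subgroup_K])

text \<open>Carrier, addition and zero of \<open>T\<close> are by definition those of the factor
  group \<open>F Mod K\<close>, so each axiom is inherited from that abelian quotient.\<close>

sublocale T: abelian_group T
proof -
  interpret Q: comm_group "F Mod K"
    by (rule F.abelian_FactGroup[OF subgroup_K])
  have T: "carrier T = carrier (F Mod K)" "add T = monoid.mult (F Mod K)"
      "\<zero>\<^bsub>T\<^esub> = \<one>\<^bsub>F Mod K\<^esub>"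
    by (simp_all add: tensor_product_def)
  show "abelian_group T"
    by (rule abelian_groupI; unfold T;
        rule Q.m_closed Q.one_closed Q.m_assoc Q.m_comm Q.l_one Q.l_inv_ex; assumption)
qed

lemma carrier_T: "carrier T = (\<lambda>c. K #>\<^bsub>F\<^esub> c) ` carrier F"
  by (simp add: tensor_product_def carrier_FactGroup)

lemma coset_closed: "c \<in> carrier F \<Longrightarrow> K #>\<^bsub>F\<^esub> c \<in> carrier T"
  by (simp add: carrier_T)

lemma coset_add:
  assumes "c \<in> carrier F" "c' \<in> carrier F"
  shows "(K #>\<^bsub>F\<^esub> c) \<oplus>\<^bsub>T\<^esub> (K #>\<^bsub>F\<^esub> c') = K #>\<^bsub>F\<^esub> (c + c')"
  using normal.rcos_sum[OF normal_K assms] by (simp add: tensor_product_def)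

text \<open>Write \<open>c = (c - c') + c'\<close>; the summand in \<open>K\<close> is absorbed by
  the coset. This is how each relator turns into an equation between tensors.\<close>

lemma coset_eqI:
  assumes "c \<in> carrier F" "c' \<in> carrier F" "c - c' \<in> K"
  shows "K #>\<^bsub>F\<^esub> c = K #>\<^bsub>F\<^esub> c'"
proof -
  have "K #>\<^bsub>F\<^esub> c = (K #>\<^bsub>F\<^esub> (c - c')) #>\<^bsub>F\<^esub> c'"
    using F.coset_mult_assoc[OF K_subset diff_F[OF assms(1,2)] assms(2)] by simp
  also have "K #>\<^bsub>F\<^esub> (c - c') = K"
    using assms K_subset subgroup_K by (intro F.coset_join2) auto
  finally show ?thesis .
qed

lemma tensor_action_closed:
  assumes "a \<in> carrier A" "c \<in> carrier F"
  shows "tensor_action I a c \<in> carrier F"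
  using assms keys_frag_extend[of "\<lambda>(i, v). frag_of (a \<odot>\<^bsub>I\<^esub> i, v)" c]
  by (fastforce simp: carrier_F tensor_action_def)

lemma tensor_action_relators:
  assumes "a \<in> carrier A" "r \<in> tensor_relators A I E"
  shows "tensor_action I a r \<in> tensor_relators A I E"
proof -
  from assms(2) consider
      (left) i i' v where "r = frag_of (i \<oplus>\<^bsub>I\<^esub> i', v) - frag_of (i, v) - frag_of (i', v)"
        "i \<in> carrier I" "i' \<in> carrier I" "v \<in> carrier E"
    | (right) i v v' where "r = frag_of (i, v \<oplus>\<^bsub>E\<^esub> v') - frag_of (i, v) - frag_of (i, v')"
        "i \<in> carrier I" "v \<in> carrier E" "v' \<in> carrier E"
    | (balance) i b v where "r = frag_of (i \<triangleleft>\<^bsub>I\<^esub> b, v) - frag_of (i, b \<odot>\<^bsub>E\<^esub> v)"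
        "i \<in> carrier I" "b \<in> carrier A" "v \<in> carrier E"
    unfolding tensor_relators_def by blast
  then show ?thesis
  proof cases
    case left
    have "a \<odot>\<^bsub>I\<^esub> i \<in> carrier I" "a \<odot>\<^bsub>I\<^esub> i' \<in> carrier I"
      using left assms(1) by auto
    then show ?thesis
      unfolding tensor_relators_def left(1) using left assms(1)
      by (simp add: tensor_action_diff tensor_action_frag_of I.smult_r_distr) blast
  next
    case right
    have "a \<odot>\<^bsub>I\<^esub> i \<in> carrier I"
      using right assms(1) by auto
    then show ?thesis
      unfolding tensor_relators_def right(1) using right
      by (simp add: tensor_action_diff tensor_action_frag_of) blast
  next
    case balance
    have "a \<odot>\<^bsub>I\<^esub> i \<in> carrier I"
      using balance assms(1) by auto
    then show ?thesis
      unfolding tensor_relators_def balance(1) using balance assms(1)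
      by (simp add: tensor_action_diff tensor_action_frag_of flip: I.smult_rsmult_assoc) blast
  qed
qed

text \<open>The action is additive and preserves the relators, hence also the subgroup they
  generate. This makes the action on cosets independent of representatives.\<close>

lemma tensor_action_kernel:
  assumes "a \<in> carrier A" "k \<in> K"
  shows "tensor_action I a k \<in> K"
  using assms(2) unfolding tensor_kernel_def
proof (induction rule: generate.induct)
  case one
  then show ?case
    using generate.one[of F] by (simp add: one_F tensor_action_def)
next
  case (incl h)
  then show ?case by (intro generate.incl tensor_action_relators assms(1))
next
  case (inv h)
  then have "tensor_action I a h \<in> tensor_relators A I E"
    by (rule tensor_action_relators[OF assms(1)])
  \<comment> \<open>Group inverses in \<open>F\<close> are negatives only for elements of its
    carrier, so \<open>relators_F\<close> is applied both to \<open>h\<close> and to its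
    image.\<close>
  with inv show ?case
    using generate.inv[of "tensor_action I a h" "tensor_relators A I E" F] relators_F
    by (simp add: inv_F subset_iff tensor_action_minus)
next
  case (eng h h')
  then show ?case
    using generate.eng[of "tensor_action I a h" F _ "tensor_action I a h'"]
    by (simp add: tensor_action_add)
qed

lemma smult_coset:
  assumes "a \<in> carrier A" "c \<in> carrier F"
  shows "a \<odot>\<^bsub>T\<^esub> (K #>\<^bsub>F\<^esub> c) = K #>\<^bsub>F\<^esub> tensor_action I a c"
proof -
  have "K <#>\<^bsub>F\<^esub> (tensor_action I a ` (K #>\<^bsub>F\<^esub> c)) = K #>\<^bsub>F\<^esub> tensor_action I a c"
  proof
    show "K <#>\<^bsub>F\<^esub> (tensor_action I a ` (K #>\<^bsub>F\<^esub> c)) \<subseteq> K #>\<^bsub>F\<^esub> tensor_action I a c"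
    proof
      fix u assume "u \<in> K <#>\<^bsub>F\<^esub> (tensor_action I a ` (K #>\<^bsub>F\<^esub> c))"
      then obtain k k' where k: "k \<in> K" "k' \<in> K" and u: "u = k + tensor_action I a (k' + c)"
        by (auto simp: set_mult_def r_coset_def)
      have "k + tensor_action I a k' \<in> K"
        using subgroup.m_closed[OF subgroup_K k(1) tensor_action_kernel[OF assms(1) k(2)]] by simp
      with u show "u \<in> K #>\<^bsub>F\<^esub> tensor_action I a c"
        by (auto simp: r_coset_def tensor_action_add add.assoc)
    qed
    \<comment> \<open>For the reverse inclusion a single representative suffices: the image of
      \<open>c\<close> plus all of \<open>K\<close> is already the whole coset.\<close>
    have "c \<in> K #>\<^bsub>F\<^esub> c"
      by (rule F.rcos_self[OF assms(2) subgroup_K])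
    then show "K #>\<^bsub>F\<^esub> tensor_action I a c \<subseteq> K <#>\<^bsub>F\<^esub> (tensor_action I a ` (K #>\<^bsub>F\<^esub> c))"
      unfolding set_mult_def r_coset_def[of F K "tensor_action I a c"] by blast
  qed
  then show ?thesis by (simp add: tensor_product_def)
qed

text \<open>Additivity is checked on representatives, where it is that of
  \<open>tensor_action\<close>. The \<open>hom\<close> form is what \<open>hom_finsum\<close>
  requires.\<close>

lemma smult_hom:
  assumes "a \<in> carrier A"
  shows "(\<lambda>t. a \<odot>\<^bsub>T\<^esub> t) \<in> hom (add_monoid T) (add_monoid T)"
proof (rule homI)
  fix t assume "t \<in> carrier (add_monoid T)"
  then show "a \<odot>\<^bsub>T\<^esub> t \<in> carrier (add_monoid T)"
    using assms by (auto simp: carrier_T smult_coset tensor_action_closed)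
next
  fix t u assume "t \<in> carrier (add_monoid T)" "u \<in> carrier (add_monoid T)"
  then obtain c c' where "c \<in> carrier F" "c' \<in> carrier F"
      "t = K #>\<^bsub>F\<^esub> c" "u = K #>\<^bsub>F\<^esub> c'"
    by (auto simp: carrier_T)
  with assms F.m_closed[of c c']
  show "a \<odot>\<^bsub>T\<^esub> (t \<otimes>\<^bsub>add_monoid T\<^esub> u) = (a \<odot>\<^bsub>T\<^esub> t) \<otimes>\<^bsub>add_monoid T\<^esub> (a \<odot>\<^bsub>T\<^esub> u)"
    by (simp add: coset_add smult_coset tensor_action_closed tensor_action_add)
qed

section \<open>Pure tensors and their relations\<close>

lemma pure_tensor_closed:
  "i \<in> carrier I \<Longrightarrow> v \<in> carrier E \<Longrightarrow> pure_tensor A I E i v \<in> carrier T"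
  by (simp add: pure_tensor_def coset_closed)

lemma smult_pure_tensor:
  assumes "a \<in> carrier A" "i \<in> carrier I" "v \<in> carrier E"
  shows "a \<odot>\<^bsub>T\<^esub> pure_tensor A I E i v = pure_tensor A I E (a \<odot>\<^bsub>I\<^esub> i) v"
  using assms by (simp add: pure_tensor_def smult_coset tensor_action_frag_of)

lemma pure_tensor_add_left:
  assumes "i \<in> carrier I" "i' \<in> carrier I" "v \<in> carrier E"
  shows "pure_tensor A I E (i \<oplus>\<^bsub>I\<^esub> i') v = pure_tensor A I E i v \<oplus>\<^bsub>T\<^esub> pure_tensor A I E i' v"
proof -
  have "frag_of (i \<oplus>\<^bsub>I\<^esub> i', v) - (frag_of (i, v) + frag_of (i', v)) \<in> K"
    \<comment> \<open>Relators subtract their terms one after the other, whereas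
      \<open>coset_eqI\<close> needs one difference with a sum; the rewriting matches the two
      forms.\<close>
    unfolding tensor_kernel_def diff_diff_add[symmetric]
    by (rule generate.incl) (use assms in \<open>unfold tensor_relators_def, blast\<close>)
  then show ?thesis
    using assms F.m_closed[of "frag_of (i, v)" "frag_of (i', v)"]
    by (simp add: pure_tensor_def coset_add coset_eqI)
qed

lemma pure_tensor_add_right:
  assumes "i \<in> carrier I" "v \<in> carrier E" "v' \<in> carrier E"
  shows "pure_tensor A I E i (v \<oplus>\<^bsub>E\<^esub> v') = pure_tensor A I E i v \<oplus>\<^bsub>T\<^esub> pure_tensor A I E i v'"
proof -
  have "frag_of (i, v \<oplus>\<^bsub>E\<^esub> v') - (frag_of (i, v) + frag_of (i, v')) \<in> K"
    unfolding tensor_kernel_def diff_diff_add[symmetric]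
    by (rule generate.incl) (use assms in \<open>unfold tensor_relators_def, blast\<close>)
  then show ?thesis
    using assms F.m_closed[of "frag_of (i, v)" "frag_of (i, v')"]
    by (simp add: pure_tensor_def coset_add coset_eqI)
qed

lemma pure_tensor_balanced:
  assumes "i \<in> carrier I" "a \<in> carrier A" "v \<in> carrier E"
  shows "pure_tensor A I E (i \<triangleleft>\<^bsub>I\<^esub> a) v = pure_tensor A I E i (a \<odot>\<^bsub>E\<^esub> v)"
proof -
  have "frag_of (i \<triangleleft>\<^bsub>I\<^esub> a, v) - frag_of (i, a \<odot>\<^bsub>E\<^esub> v) \<in> K"
    unfolding tensor_kernel_def
    by (rule generate.incl) (use assms in \<open>unfold tensor_relators_def, blast\<close>)
  then show ?thesis
    using assms by (simp add: pure_tensor_def coset_eqI I.rsmult_closed)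
qed

text \<open>Additivity in each slot in the form of \<open>hom\<close>: this one is composed with
  \<open>d\<close> and a coordinate functional, while the one for the right slot carries a finite
  sum through the tensor sign.\<close>

lemma pure_tensor_hom_left:
  "v \<in> carrier E \<Longrightarrow> (\<lambda>i. pure_tensor A I E i v) \<in> hom (add_monoid I) (add_monoid T)"
  by (rule homI) (auto simp: pure_tensor_closed pure_tensor_add_left)

lemma pure_tensor_hom_right:
  "i \<in> carrier I \<Longrightarrow> (\<lambda>v. pure_tensor A I E i v) \<in> hom (add_monoid E) (add_monoid T)"
  by (rule homI) (auto simp: pure_tensor_closed pure_tensor_add_right)

end

section \<open>Dual elements and derivations\<close>

lemma self_bimodule_simps [simp]:
  "carrier (self_bimodule A) = carrier A" "add (self_bimodule A) = add A"
  "a \<odot>\<^bsub>self_bimodule A\<^esub> b = a \<otimes>\<^bsub>A\<^esub> b" "b \<triangleleft>\<^bsub>self_bimodule A\<^esub> a = b \<otimes>\<^bsub>A\<^esub> a"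
  by (simp_all add: self_bimodule_def)

lemma dual_moduleD:
  assumes "f \<in> dual_module A E"
  shows "f \<in> hom (add_monoid E) (add_monoid A)"
    and "\<lbrakk>a \<in> carrier A; v \<in> carrier E\<rbrakk> \<Longrightarrow> f (a \<odot>\<^bsub>E\<^esub> v) = a \<otimes>\<^bsub>A\<^esub> f v"
    and "v \<in> carrier E \<Longrightarrow> f v \<in> carrier A"
  using assms by (auto simp: dual_module_def module_hom_def hom_def)

lemma derivationsD:
  assumes "d \<in> derivations A I"
  shows "d \<in> hom (add_monoid A) (add_monoid I)"
    and "\<lbrakk>a \<in> carrier A; b \<in> carrier A\<rbrakk> \<Longrightarrow> d (a \<otimes>\<^bsub>A\<^esub> b) = a \<odot>\<^bsub>I\<^esub> d b \<oplus>\<^bsub>I\<^esub> d a \<triangleleft>\<^bsub>I\<^esub> b"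
    and "a \<in> carrier A \<Longrightarrow> d a \<in> carrier I"
  using assms by (auto simp: derivations_def hom_def)

section \<open>The two connections\<close>

lemma (in tensor_factors) connection_projective_basis:
  assumes basis: "projective_basis A E n e x" and d: "d \<in> derivations A I"
  shows "connection A I E d
    (\<lambda>v. \<Oplus>\<^bsub>T\<^esub>i\<in>{1..n}. pure_tensor A I E (d (x i v)) (e i))"
  unfolding connection_def
proof (intro conjI ballI)
  have e: "\<And>j. j \<in> {1..n} \<Longrightarrow> e j \<in> carrier E"
    and x: "\<And>j. j \<in> {1..n} \<Longrightarrow> x j \<in> dual_module A E"
    and expand: "\<And>v. v \<in> carrier E \<Longrightarrow> (\<Oplus>\<^bsub>E\<^esub>j\<in>{1..n}. x j v \<odot>\<^bsub>E\<^esub> e j) = v"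
    using basis by (auto simp: projective_basis_def)
  note xc = dual_moduleD(3)[OF x] and dc = derivationsD(3)[OF d]
  \<comment> \<open>Each summand is a composite of three additive maps: \<open>x j\<close>, then
    \<open>d\<close>, then tensoring with \<open>e j\<close>.\<close>
  have "(\<lambda>v. pure_tensor A I E (d (x j v)) (e j)) \<in> hom (add_monoid E) (add_monoid T)"
    if j: "j \<in> {1..n}" for j
    using hom_compose[OF dual_moduleD(1)[OF x[OF j]]
        hom_compose[OF derivationsD(1)[OF d] pure_tensor_hom_left[OF e[OF j]]]]
    by (simp add: o_def)
  then show "(\<lambda>v. \<Oplus>\<^bsub>T\<^esub>i\<in>{1..n}. pure_tensor A I E (d (x i v)) (e i))
      \<in> hom (add_monoid E) (add_monoid T)"
    by (rule T.finsum_hom_add)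
  fix a v assume a: "a \<in> carrier A" and v: "v \<in> carrier E"
  let ?s = "\<lambda>j. pure_tensor A I E (d (x j v)) (e j)"
  let ?t = "\<lambda>j. pure_tensor A I E (d a) (x j v \<odot>\<^bsub>E\<^esub> e j)"
  have s: "?s \<in> {1..n} \<rightarrow> carrier T" and as: "(\<lambda>j. a \<odot>\<^bsub>T\<^esub> ?s j) \<in> {1..n} \<rightarrow> carrier T"
    and t: "?t \<in> {1..n} \<rightarrow> carrier T"
    using a v e xc dc by (auto simp: smult_pure_tensor intro!: pure_tensor_closed)
  \<comment> \<open>Linearity of \<open>x j\<close> and the Leibniz rule give two terms. In the
    second, balancing moves the right factor \<open>x j v\<close> from \<open>d a\<close> over to
    \<open>e j\<close>.\<close>
  have "pure_tensor A I E (d (x j (a \<odot>\<^bsub>E\<^esub> v))) (e j) = a \<odot>\<^bsub>T\<^esub> ?s j \<oplus>\<^bsub>T\<^esub> ?t j"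
    if j: "j \<in> {1..n}" for j
    using a v e[OF j] xc[OF j] dc
    by (simp add: dual_moduleD(2)[OF x[OF j]] derivationsD(2)[OF d] pure_tensor_add_left
        I.rsmult_closed smult_pure_tensor pure_tensor_balanced)
  then have "(\<Oplus>\<^bsub>T\<^esub>j\<in>{1..n}. pure_tensor A I E (d (x j (a \<odot>\<^bsub>E\<^esub> v))) (e j))
      = (\<Oplus>\<^bsub>T\<^esub>j\<in>{1..n}. a \<odot>\<^bsub>T\<^esub> ?s j \<oplus>\<^bsub>T\<^esub> ?t j)"
    using as t by (intro T.finsum_cong') auto
  also have "\<dots> = (\<Oplus>\<^bsub>T\<^esub>j\<in>{1..n}. a \<odot>\<^bsub>T\<^esub> ?s j) \<oplus>\<^bsub>T\<^esub> (\<Oplus>\<^bsub>T\<^esub>j\<in>{1..n}. ?t j)"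
    by (rule T.finsum_addf[OF as t])
  also have "(\<Oplus>\<^bsub>T\<^esub>j\<in>{1..n}. a \<odot>\<^bsub>T\<^esub> ?s j) = a \<odot>\<^bsub>T\<^esub> (\<Oplus>\<^bsub>T\<^esub>j\<in>{1..n}. ?s j)"
    by (rule hom_finsum[OF T.abelian_group_axioms T.abelian_group_axioms smult_hom[OF a] s, symmetric])
       simp
  \<comment> \<open>All these tensors share the left entry \<open>d a\<close>, so their sum is one
    tensor, whose right entry is the basis expansion of \<open>v\<close>.\<close>
  also have "(\<Oplus>\<^bsub>T\<^esub>j\<in>{1..n}. ?t j) = pure_tensor A I E (d a) (\<Oplus>\<^bsub>E\<^esub>j\<in>{1..n}. x j v \<odot>\<^bsub>E\<^esub> e j)"
    by (rule hom_finsum[OF E.abelian_group_axioms T.abelian_group_axioms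
          pure_tensor_hom_right[OF dc[OF a]], symmetric])
       (use e xc v in auto)
  finally show "(\<Oplus>\<^bsub>T\<^esub>j\<in>{1..n}. pure_tensor A I E (d (x j (a \<odot>\<^bsub>E\<^esub> v))) (e j))
      = a \<odot>\<^bsub>T\<^esub> (\<Oplus>\<^bsub>T\<^esub>j\<in>{1..n}. ?s j) \<oplus>\<^bsub>T\<^esub> pure_tensor A I E (d a) v"
    by (simp only: expand[OF v])
qed

text \<open>The Leibniz computation is the one for \<open>connection_projective_basis\<close>,
  carried out in \<open>E\<close> itself with products in place of tensors. Linearity in the
  derivation is an additional claim and is checked one summand at a time.\<close>

lemma der_connection_projective_basis:
  fixes A :: "('a, 'r) ring_scheme" and E :: "('a, 'e, 's) module_scheme"
  assumes "module A E" and basis: "projective_basis A E n e x"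
  shows "der_connection A E (\<lambda>\<delta>. \<lambda>v\<in>carrier E. \<Oplus>\<^bsub>E\<^esub>i\<in>{1..n}. \<delta> (x i v) \<odot>\<^bsub>E\<^esub> e i)"
    (is "der_connection A E ?D")
proof -
  interpret E: module A E by fact
  have e: "\<And>j. j \<in> {1..n} \<Longrightarrow> e j \<in> carrier E"
    and x: "\<And>j. j \<in> {1..n} \<Longrightarrow> x j \<in> dual_module A E"
    and expand: "\<And>v. v \<in> carrier E \<Longrightarrow> (\<Oplus>\<^bsub>E\<^esub>j\<in>{1..n}. x j v \<odot>\<^bsub>E\<^esub> e j) = v"
    using basis by (auto simp: projective_basis_def)
  note xc = dual_moduleD(3)[OF x]
  let ?Der = "derivations A (self_bimodule A)"
  have dc: "\<delta> a \<in> carrier A" if "\<delta> \<in> ?Der" "a \<in> carrier A" for \<delta> a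
    using derivationsD(3)[OF that] by simp
  have sc: "(\<lambda>j. \<delta> (x j v) \<odot>\<^bsub>E\<^esub> e j) \<in> {1..n} \<rightarrow> carrier E"
    if "\<delta> \<in> ?Der" "v \<in> carrier E" for \<delta> v
    using that e xc dc by auto
  have add: "(\<lambda>v. \<Oplus>\<^bsub>E\<^esub>j\<in>{1..n}. \<delta> (x j v) \<odot>\<^bsub>E\<^esub> e j) \<in> hom (add_monoid E) (add_monoid E)"
    if \<delta>: "\<delta> \<in> ?Der" for \<delta>
  proof (rule E.finsum_hom_add)
    fix j assume j: "j \<in> {1..n}"
    \<comment> \<open>The records \<open>self_bimodule A\<close> and \<open>A\<close> differ but
      share carrier and addition, so unfolding \<open>hom\<close> identifies the two sets of
      homomorphisms.\<close>
    have "\<delta> \<in> hom (add_monoid A) (add_monoid A)"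
      using derivationsD(1)[OF \<delta>] by (simp add: hom_def)
    moreover have "(\<lambda>a. a \<odot>\<^bsub>E\<^esub> e j) \<in> hom (add_monoid A) (add_monoid E)"
      using e[OF j] by (auto intro!: homI simp: E.smult_l_distr)
    ultimately show "(\<lambda>v. \<delta> (x j v) \<odot>\<^bsub>E\<^esub> e j) \<in> hom (add_monoid E) (add_monoid E)"
      using hom_compose[OF dual_moduleD(1)[OF x[OF j]] hom_compose] by (fastforce simp: o_def)
  qed
  have D_hom: "?D \<in> hom (add_monoid (derivation_module A (self_bimodule A))) (add_monoid (endo_module E))"
  proof (rule homI)
    fix \<delta> assume "\<delta> \<in> carrier (add_monoid (derivation_module A (self_bimodule A)))"
    then have "\<delta> \<in> ?Der" by (simp add: derivation_module_def)
    from add[OF this] show "?D \<delta> \<in> carrier (add_monoid (endo_module E))"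
      by (auto simp: endo_module_def hom_def)
  next
    fix \<delta> \<delta>'
    assume "\<delta> \<in> carrier (add_monoid (derivation_module A (self_bimodule A)))"
      and "\<delta>' \<in> carrier (add_monoid (derivation_module A (self_bimodule A)))"
    then have \<delta>: "\<delta> \<in> ?Der" "\<delta>' \<in> ?Der" by (simp_all add: derivation_module_def)
    \<comment> \<open>Addition of derivations is pointwise but restricted to
      \<open>carrier A\<close>. The restriction disappears here because every \<open>x j v\<close>
      lies in that carrier.\<close>
    have "(\<Oplus>\<^bsub>E\<^esub>j\<in>{1..n}. (\<lambda>b\<in>carrier A. \<delta> b \<oplus>\<^bsub>A\<^esub> \<delta>' b) (x j v) \<odot>\<^bsub>E\<^esub> e j)
        = (\<Oplus>\<^bsub>E\<^esub>j\<in>{1..n}. \<delta> (x j v) \<odot>\<^bsub>E\<^esub> e j) \<oplus>\<^bsub>E\<^esub> (\<Oplus>\<^bsub>E\<^esub>j\<in>{1..n}. \<delta>' (x j v) \<odot>\<^bsub>E\<^esub> e j)"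
      if v: "v \<in> carrier E" for v
      unfolding E.finsum_addf[OF sc[OF \<delta>(1) v] sc[OF \<delta>(2) v], symmetric]
      using \<delta> v e xc dc by (intro E.finsum_cong') (auto simp: E.smult_l_distr)
    then show "?D (\<delta> \<otimes>\<^bsub>add_monoid (derivation_module A (self_bimodule A))\<^esub> \<delta>')
        = ?D \<delta> \<otimes>\<^bsub>add_monoid (endo_module E)\<^esub> ?D \<delta>'"
      by (auto simp: derivation_module_def endo_module_def intro!: restrict_ext)
  qed
  have D_smult: "?D (a \<odot>\<^bsub>derivation_module A (self_bimodule A)\<^esub> \<delta>) = a \<odot>\<^bsub>endo_module E\<^esub> ?D \<delta>"
    if a: "a \<in> carrier A" and \<delta>: "\<delta> \<in> ?Der" for a \<delta>
  proof -
    have "(\<Oplus>\<^bsub>E\<^esub>j\<in>{1..n}. (\<lambda>b\<in>carrier A. a \<otimes>\<^bsub>A\<^esub> \<delta> b) (x j v) \<odot>\<^bsub>E\<^esub> e j)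
        = a \<odot>\<^bsub>E\<^esub> (\<Oplus>\<^bsub>E\<^esub>j\<in>{1..n}. \<delta> (x j v) \<odot>\<^bsub>E\<^esub> e j)" if v: "v \<in> carrier E" for v
      unfolding E.finsum_smult_ldistr[OF finite_atLeastAtMost a sc[OF \<delta> v]]
      using \<delta> v a e xc dc by (intro E.finsum_cong') (auto simp: E.smult_assoc1)
    then show ?thesis
      by (auto simp: derivation_module_def endo_module_def intro!: restrict_ext)
  qed
  have D_leibniz: "?D \<delta> (a \<odot>\<^bsub>E\<^esub> v) = a \<odot>\<^bsub>E\<^esub> ?D \<delta> v \<oplus>\<^bsub>E\<^esub> \<delta> a \<odot>\<^bsub>E\<^esub> v"
    if \<delta>: "\<delta> \<in> ?Der" and a: "a \<in> carrier A" and v: "v \<in> carrier E" for \<delta> a v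
  proof -
    let ?s = "\<lambda>j. \<delta> (x j v) \<odot>\<^bsub>E\<^esub> e j" and ?t = "\<lambda>j. x j v \<odot>\<^bsub>E\<^esub> e j"
    have s: "(\<lambda>j. a \<odot>\<^bsub>E\<^esub> ?s j) \<in> {1..n} \<rightarrow> carrier E" and t: "?t \<in> {1..n} \<rightarrow> carrier E"
      and \<delta>t: "(\<lambda>j. \<delta> a \<odot>\<^bsub>E\<^esub> ?t j) \<in> {1..n} \<rightarrow> carrier E"
      using \<delta> a v e xc dc by auto
    have step: "\<delta> (x j (a \<odot>\<^bsub>E\<^esub> v)) \<odot>\<^bsub>E\<^esub> e j = a \<odot>\<^bsub>E\<^esub> ?s j \<oplus>\<^bsub>E\<^esub> \<delta> a \<odot>\<^bsub>E\<^esub> ?t j"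
      if j: "j \<in> {1..n}" for j
      using a v e[OF j] xc[OF j] dc[OF \<delta>] derivationsD(2)[OF \<delta>]
      by (simp add: dual_moduleD(2)[OF x[OF j]] E.smult_l_distr E.smult_assoc1)
    have "?D \<delta> (a \<odot>\<^bsub>E\<^esub> v) = (\<Oplus>\<^bsub>E\<^esub>j\<in>{1..n}. a \<odot>\<^bsub>E\<^esub> ?s j \<oplus>\<^bsub>E\<^esub> \<delta> a \<odot>\<^bsub>E\<^esub> ?t j)"
      unfolding restrict_apply'[OF E.smult_closed[OF a v]]
      using s \<delta>t by (intro E.finsum_cong' step) auto
    also have "\<dots> = a \<odot>\<^bsub>E\<^esub> (\<Oplus>\<^bsub>E\<^esub>j\<in>{1..n}. ?s j) \<oplus>\<^bsub>E\<^esub> \<delta> a \<odot>\<^bsub>E\<^esub> (\<Oplus>\<^bsub>E\<^esub>j\<in>{1..n}. ?t j)"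
      by (simp only: E.finsum_addf[OF s \<delta>t] finite_atLeastAtMost
          E.finsum_smult_ldistr[OF _ a sc[OF \<delta> v]] E.finsum_smult_ldistr[OF _ dc[OF \<delta> a] t])
    also have "\<dots> = a \<odot>\<^bsub>E\<^esub> ?D \<delta> v \<oplus>\<^bsub>E\<^esub> \<delta> a \<odot>\<^bsub>E\<^esub> v"
      \<comment> \<open>The second sum is the basis expansion of \<open>v\<close>, which leaves
        exactly the Leibniz term.\<close>
      using v expand by simp
    finally show ?thesis .
  qed
  have "carrier (derivation_module A (self_bimodule A)) = ?Der"
    by (simp add: derivation_module_def)
  then show ?thesis
    unfolding der_connection_def module_hom_def using D_hom D_smult D_leibniz by blast
qed

theorem theorem2p8:
  fixes A :: "('a, 'r) ring_scheme"
    and E :: "('a, 'e, 's) module_scheme"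
    and I :: "('a, 'i, 't) bimodule_scheme"
    and n :: nat
    and e :: "nat \<Rightarrow> 'e"
    and x :: "nat \<Rightarrow> 'e \<Rightarrow> 'a"
    and d :: "'a \<Rightarrow> 'i"
  assumes "cring A"
    and "module A E"
    and "projective_basis A E n e x"
    and "bimodule A I"
    and "d \<in> derivations A I"
  shows "connection A I E d
           (\<lambda>v. \<Oplus>\<^bsub>tensor_product A I E\<^esub>i\<in>{1..n}. pure_tensor A I E (d (x i v)) (e i)) \<and>
         der_connection A E
           (\<lambda>\<delta>. \<lambda>v\<in>carrier E. \<Oplus>\<^bsub>E\<^esub>i\<in>{1..n}. \<delta> (x i v) \<odot>\<^bsub>E\<^esub> e i)"
proof
  interpret tensor_factors A I E
    by (intro tensor_factors.intro assms)
  show "connection A I E d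
      (\<lambda>v. \<Oplus>\<^bsub>tensor_product A I E\<^esub>i\<in>{1..n}. pure_tensor A I E (d (x i v)) (e i))"
    by (rule connection_projective_basis[OF assms(3,5)])
  show "der_connection A E (\<lambda>\<delta>. \<lambda>v\<in>carrier E. \<Oplus>\<^bsub>E\<^esub>i\<in>{1..n}. \<delta> (x i v) \<odot>\<^bsub>E\<^esub> e i)"
    by (rule der_connection_projective_basis[OF assms(2,3)])
qed

end
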